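(* Let $\mathcal B,\mathcal B^*$ be matroids on a finite set $X$ and $B\mapsto B^*$ a linking $\mathcal B\to\mathcal B^*$. Let $\omega,\pi,a,z,\varepsilon$ be as in the context. Suppose $Q$ is a non-branching almost-basis of $\mathcal B$ and $\varphi(Q)^*=A+a$ or $\varphi(Q)^*=A+z$ for some branching almost-basis $A$ of $\mathcal B^*$. Then $\varepsilon(Q)$ is also a non-branching almost-basis of $\mathcal B$, and both $Q$ and $\varepsilon(Q)$ are balanced.
   Context: A pre-matroid on a finite set $X$ is a non-empty set of subsets of $X$ (bases). For $Y\subseteq X$, $x\notin Y$, $Y+x=Y\cup\{x\}$; for $y\in Y$, $Y-y=Y\setminus\{y\}$. An almost-basis of a pre-matroid $\mathcal C$ is $B-x$ with $B\in\mathcal C$, $x\in B$; $U(D)=\{x\notin D: D+x\in\mathcal C\}$. A matroid is a pre-matroid such that for all bases $B_1,B_2$ and $x\in B_1\setminus B_2$ there is $y\in B_2\setminus B_1$ with $B_1-x+y$ a basis. A transposition of $X$ exchanges two distinct elements and fixes the rest; it acts on subsets elementwise. A bijection $\mathcal B\to\mathcal B^*$, $B\mapsto B^*$, is a linking if for all $B\in\mathcal B$ and transpositions $\tau$: (L1) if $\tau(B)\in\mathcal B$ then $\tau(B^* )\in\mathcal B^*$ and $\tau(B^* )=\tau(B)^*$; (L2) if $\tau(B^* )\in\mathcal B^*$ then $\tau(B)\in\mathcal B$ and $\tau(B^* )=\tau(B)^*$. For a linear order $\rho$ and an almost-basis $D$ of a pre-matroid, $\varphi_\rho(D)=D+\min_\rho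 U(D)$ (computed in that pre-matroid). Let $\omega$ be a linear order on $X$, $a\ne z$ elements consecutive for $\omega$ (nothing strictly between them) with $a<_\omega z$, $\varepsilon$ the transposition of $a,z$, and $\pi$ the linear order agreeing with $\omega$ on all pairs except that $z<_\pi a$. An almost-basis $D$ (of $\mathcal B$ or of $\mathcal B^*$) is branching if $\varphi_\omega(D)\ne\varphi_\pi(D)$ and non-branching otherwise, in which case $\varphi(D)$ denotes the common value. An almost-basis $Q$ of $\mathcal B$ is $\omega$-balanced if $\varepsilon(Q)$ is an almost-basis of $\mathcal B$ and $\varepsilon(\varphi_\omega(Q))=\varphi_\pi(\varepsilon(Q))$; $\pi$-balanced if $\varepsilon(Q)$ is an almost-basis and $\varepsilon(\varphi_\pi(Q))=\varphi_\omega(\varepsilon(Q))$; balanced if both. *)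

theory Defs
  imports Main "HOL-Combinatorics.Transposition"
begin

definition pre_matroid :: "'a set \<Rightarrow> 'a set set \<Rightarrow> bool" where
  "pre_matroid X C \<longleftrightarrow> finite X \<and> C \<noteq> {} \<and> C \<subseteq> Pow X"

definition almost_basis :: "'a set set \<Rightarrow> 'a set \<Rightarrow> bool" where
  "almost_basis C D \<longleftrightarrow> (\<exists>B\<in>C. \<exists>x\<in>B. D = B - {x})"

text \<open>All members of \<open>C\<close> being subsets of the ground set, the elements collected here lie in the
  ground set automatically.\<close>

definition completions :: "'a set set \<Rightarrow> 'a set \<Rightarrow> 'a set" where
  "completions C D = {x. x \<notin> D \<and> insert x D \<in> C}"

definition matroid :: "'a set \<Rightarrow> 'a set set \<Rightarrow> bool" where
  "matroid X C \<longleftrightarrow> pre_matroid X C \<and>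
     (\<forall>B1\<in>C. \<forall>B2\<in>C. \<forall>x \<in> B1 - B2. \<exists>y \<in> B2 - B1. insert y (B1 - {x}) \<in> C)"

definition linking :: "'a set \<Rightarrow> 'a set set \<Rightarrow> 'a set set \<Rightarrow> ('a set \<Rightarrow> 'a set) \<Rightarrow> bool" where
  "linking X C C' s \<longleftrightarrow> bij_betw s C C' \<and>
     (\<forall>B\<in>C. \<forall>x\<in>X. \<forall>y\<in>X. x \<noteq> y \<longrightarrow>
        (transpose x y ` B \<in> C \<longrightarrow>
           transpose x y ` s B \<in> C' \<and> transpose x y ` s B = s (transpose x y ` B)) \<and>
        (transpose x y ` s B \<in> C' \<longrightarrow>
           transpose x y ` B \<in> C \<and> transpose x y ` s B = s (transpose x y ` B)))"

text \<open>Linear orders on the ground set are reflexive relations in the sense of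
  \<^const>\<open>linear_order_on\<close>. Although \<^const>\<open>wo_rel.minim\<close> comes from a locale of well-orders, its
  definition is just ``the least element of a set with respect to a relation''; a linear order on
  a finite set is a well-order.\<close>

definition min_completion :: "'a set set \<Rightarrow> 'a rel \<Rightarrow> 'a set \<Rightarrow> 'a set" where
  "min_completion C \<rho> D = insert (wo_rel.minim \<rho> (completions C D)) D"

definition consecutive :: "'a set \<Rightarrow> 'a rel \<Rightarrow> 'a \<Rightarrow> 'a \<Rightarrow> bool" where
  "consecutive X \<omega> a z \<longleftrightarrow> a \<in> X \<and> z \<in> X \<and> a \<noteq> z \<and> (a, z) \<in> \<omega> \<and>
     \<not> (\<exists>x\<in>X. x \<noteq> a \<and> x \<noteq> z \<and> (a, x) \<in> \<omega> \<and> (x, z) \<in> \<omega>)"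

definition agree_except_swap :: "'a rel \<Rightarrow> 'a rel \<Rightarrow> 'a \<Rightarrow> 'a \<Rightarrow> bool" where
  "agree_except_swap \<omega> \<pi> a z \<longleftrightarrow>
     (\<forall>x y. {x, y} \<noteq> {a, z} \<longrightarrow> ((x, y) \<in> \<pi> \<longleftrightarrow> (x, y) \<in> \<omega>)) \<and> (z, a) \<in> \<pi>"

definition branching :: "'a set set \<Rightarrow> 'a rel \<Rightarrow> 'a rel \<Rightarrow> 'a set \<Rightarrow> bool" where
  "branching C \<omega> \<pi> D \<longleftrightarrow>
     almost_basis C D \<and> min_completion C \<omega> D \<noteq> min_completion C \<pi> D"

definition nonbranching :: "'a set set \<Rightarrow> 'a rel \<Rightarrow> 'a rel \<Rightarrow> 'a set \<Rightarrow> bool" where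
  "nonbranching C \<omega> \<pi> D \<longleftrightarrow>
     almost_basis C D \<and> min_completion C \<omega> D = min_completion C \<pi> D"

text \<open>For \<open>\<epsilon>\<close> the transposition of \<open>a\<close> and \<open>z\<close>, \<open>\<omega>\<close>-balanced is \<open>balanced_from C \<epsilon> \<omega> \<pi>\<close> and
  \<open>\<pi>\<close>-balanced is \<open>balanced_from C \<epsilon> \<pi> \<omega>\<close>.\<close>

definition balanced_from ::
    "'a set set \<Rightarrow> ('a \<Rightarrow> 'a) \<Rightarrow> 'a rel \<Rightarrow> 'a rel \<Rightarrow> 'a set \<Rightarrow> bool" where
  "balanced_from C \<epsilon> \<rho> \<sigma> Q \<longleftrightarrow> almost_basis C Q \<and> almost_basis C (\<epsilon> ` Q) \<and>
     \<epsilon> ` min_completion C \<rho> Q = min_completion C \<sigma> (\<epsilon> ` Q)"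

definition balanced ::
    "'a set set \<Rightarrow> ('a \<Rightarrow> 'a) \<Rightarrow> 'a rel \<Rightarrow> 'a rel \<Rightarrow> 'a set \<Rightarrow> bool" where
  "balanced C \<epsilon> \<omega> \<pi> Q \<longleftrightarrow> balanced_from C \<epsilon> \<omega> \<pi> Q \<and> balanced_from C \<epsilon> \<pi> \<omega> Q"

end

theory Submission
  imports Defs
begin

text \<open>Let \<open>P = \<phi>(Q) = Q + p\<close>. As \<open>A\<close> is branching, \<open>a\<close> and \<open>z\<close> are the two smallest elements of its
  completion set, so \<open>\<epsilon>(P\<^sup>*)\<close> is a basis; by (L2) so is \<open>\<epsilon>(P)\<close>, and \<open>\<epsilon>(P) \<noteq> P\<close>. Non-branching of \<open>Q\<close>
  excludes \<open>p \<in> {a, z}\<close>, so \<open>Q\<close> contains exactly one of \<open>a\<close>, \<open>z\<close> and \<open>\<epsilon>(P) = \<epsilon>(Q) + p\<close>. If some \<open>x < p\<close>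
  also completed \<open>\<epsilon>(Q)\<close>, then basis exchange in \<open>\<B>\<close> would give \<open>x < p < a, z\<close>, while the linking,
  applied to the transposition of \<open>x\<close> and \<open>p\<close>, and basis exchange in \<open>\<B>\<^sup>*\<close> would show that one of
  \<open>x\<close>, \<open>p\<close> completes \<open>A\<close>, contradicting the minimality of \<open>a\<close>.\<close>

lemma linear_orderD:
  assumes "linear_order_on X r"
  shows "x \<in> X \<Longrightarrow> (x, x) \<in> r"
    and "(x, y) \<in> r \<Longrightarrow> (y, w) \<in> r \<Longrightarrow> (x, w) \<in> r"
    and "(x, y) \<in> r \<Longrightarrow> (y, x) \<in> r \<Longrightarrow> x = y"
    and "x \<in> X \<Longrightarrow> y \<in> X \<Longrightarrow> (x, y) \<in> r \<or> (y, x) \<in> r"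
  using assms by (auto simp: order_on_defs dest: refl_onD transD antisymD)
    (metis refl_onD total_on_def)

text \<open>On a finite ground set this makes the facts about \<open>wo_rel.minim\<close> available
  for \<open>\<omega>\<close> and \<open>\<pi>\<close>.\<close>

lemma finite_linear_order_wo_rel:
  assumes "finite X" "linear_order_on X r"
  shows "wo_rel r" "Field r = X"
proof -
  have "r \<subseteq> X \<times> X" using assms(2) by (simp add: order_on_defs)
  then have "finite r" using assms(1) finite_subset by blast
  then have "well_order_on X r" using assms(2) linear_order_on_well_order_on by blast
  then show "wo_rel r" "Field r = X"
    using well_order_on_Well_order by (auto simp: wo_rel_def)
qed

text \<open>Each minimum precedes the other in its own order, so two different minima form a pair on
  which the orders disagree, and \<open>{a, z}\<close> is the only such pair.\<close>

lemma minim_swap: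
  assumes "finite X" and \<omega>: "linear_order_on X \<omega>" and \<pi>: "linear_order_on X \<pi>"
    and swap: "agree_except_swap \<omega> \<pi> a z" and az: "(a, z) \<in> \<omega>"
    and S: "S \<noteq> {}" "S \<subseteq> X" and ne: "wo_rel.minim \<omega> S \<noteq> wo_rel.minim \<pi> S"
  shows "wo_rel.minim \<omega> S = a" "wo_rel.minim \<pi> S = z"
proof -
  let ?b = "wo_rel.minim \<omega> S" and ?c = "wo_rel.minim \<pi> S"
  note wo\<omega> = finite_linear_order_wo_rel[OF assms(1) \<omega>]
    and wo\<pi> = finite_linear_order_wo_rel[OF assms(1) \<pi>]
  have "?b \<in> S" "?c \<in> S"
    using wo_rel.minim_in[OF wo\<omega>(1)] wo_rel.minim_in[OF wo\<pi>(1)] wo\<omega>(2) wo\<pi>(2) S by auto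
  then have bc: "(?b, ?c) \<in> \<omega>" "(?c, ?b) \<in> \<pi>"
    using wo_rel.minim_least[OF wo\<omega>(1)] wo_rel.minim_least[OF wo\<pi>(1)] wo\<omega>(2) wo\<pi>(2) S(2)
    by auto
  have "{?b, ?c} = {a, z}"
  proof (rule ccontr)
    assume "{?b, ?c} \<noteq> {a, z}"
    then have "{?c, ?b} \<noteq> {a, z}" by (simp add: insert_commute)
    then have "(?c, ?b) \<in> \<omega>"
      using swap bc(2) unfolding agree_except_swap_def by blast
    then show False using linear_orderD(3)[OF \<omega> bc(1)] ne by blast
  qed
  then show "?b = a" "?c = z"
    using bc(1) az ne linear_orderD(3)[OF \<omega>] by (auto simp: doubleton_eq_iff)
qed

lemma completions_in_ground:
  assumes "matroid X C"
  shows "completions C D \<subseteq> X"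
proof -
  have "C \<subseteq> Pow X"
    using assms by (simp add: matroid_def pre_matroid_def)
  then show ?thesis unfolding completions_def by auto
qed

lemma completions_nonempty:
  assumes "almost_basis C D"
  shows "completions C D \<noteq> {}"
proof -
  obtain B x where "B \<in> C" "x \<in> B" "D = B - {x}"
    using assms unfolding almost_basis_def by auto
  then have "x \<in> completions C D" by (simp add: completions_def insert_absorb)
  then show ?thesis by auto
qed

lemma minim_completions:
  assumes "matroid X C" "linear_order_on X r" "almost_basis C D"
  shows "wo_rel.minim r (completions C D) \<in> completions C D"
    and "x \<in> completions C D \<Longrightarrow> (wo_rel.minim r (completions C D), x) \<in> r"
proof -
  have "finite X" using assms(1) by (simp add: matroid_def pre_matroid_def)
  note wo = finite_linear_order_wo_rel[OF this assms(2)]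
  have "completions C D \<subseteq> Field r"
    using completions_in_ground[OF assms(1)] wo(2) by simp
  then show "wo_rel.minim r (completions C D) \<in> completions C D"
    and "x \<in> completions C D \<Longrightarrow> (wo_rel.minim r (completions C D), x) \<in> r"
    using wo_rel.minim_in[OF wo(1)] wo_rel.minim_least[OF wo(1)] completions_nonempty[OF assms(3)]
    by auto
qed

lemma min_completion_eq:
  assumes "matroid X C" "linear_order_on X r"
    and "b \<in> completions C D" "\<And>x. x \<in> completions C D \<Longrightarrow> (b, x) \<in> r"
  shows "min_completion C r D = insert b D"
proof -
  have "finite X" using assms(1) by (simp add: matroid_def pre_matroid_def)
  note wo = finite_linear_order_wo_rel[OF this assms(2)]
  have "completions C D \<subseteq> Field r"
    using completions_in_ground[OF assms(1)] wo(2) by simp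
  then show ?thesis
    using wo_rel.equals_minim[OF wo(1) _ assms(3,4)] by (simp add: min_completion_def)
qed

lemma almost_basis_completion:
  assumes "x \<in> completions C D"
  shows "almost_basis C D"
proof -
  have "insert x D \<in> C" "D = insert x D - {x}"
    using assms by (auto simp: completions_def)
  then show ?thesis unfolding almost_basis_def by blast
qed

lemma branchingD:
  assumes "matroid X C" "linear_order_on X \<omega>" "linear_order_on X \<pi>"
    and "agree_except_swap \<omega> \<pi> a z" "(a, z) \<in> \<omega>" "branching C \<omega> \<pi> D"
  shows "a \<in> completions C D" "z \<in> completions C D" "x \<in> completions C D \<Longrightarrow> (a, x) \<in> \<omega>"
proof -
  have fin: "finite X" using assms(1) by (simp add: matroid_def pre_matroid_def)
  have D: "almost_basis C D"
    and ne: "wo_rel.minim \<omega> (completions C D) \<noteq> wo_rel.minim \<pi> (completions C D)"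
    using assms(6) unfolding branching_def min_completion_def by auto
  note w = minim_completions[OF assms(1,2) D] and p = minim_completions[OF assms(1,3) D]
  have "wo_rel.minim \<omega> (completions C D) = a" "wo_rel.minim \<pi> (completions C D) = z"
    using minim_swap[OF fin assms(2-5) completions_nonempty[OF D]
        completions_in_ground[OF assms(1)] ne] by blast+
  then show "a \<in> completions C D" "z \<in> completions C D" "x \<in> completions C D \<Longrightarrow> (a, x) \<in> \<omega>"
    using w p by auto
qed

text \<open>Exchange \<open>u\<close> out of \<open>insert t (insert u R)\<close> against the other
  basis: only \<open>s\<close> or \<open>v\<close> can replace it, and the assumed non-basis rules
  out \<open>v\<close>. This is used once in each of the two matroids.\<close>

lemma matroid_pair_exchange:
  assumes "matroid X C" "insert s (insert v R) \<in> C" "insert t (insert u R) \<in> C"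
    and "insert t (insert v R) \<notin> C" "u \<notin> R" "u \<noteq> t" "u \<noteq> s" "u \<noteq> v"
  shows "insert t (insert s R) \<in> C"
proof -
  have "u \<in> insert t (insert u R) - insert s (insert v R)" using assms by auto
  then obtain y where y: "y \<in> insert s (insert v R) - insert t (insert u R)"
    and C: "insert y (insert t (insert u R) - {u}) \<in> C"
    using assms(1-3) unfolding matroid_def by meson
  have "insert t (insert u R) - {u} = insert t R" using assms by auto
  then have "insert t (insert y R) \<in> C" using C by (simp add: insert_commute)
  moreover from this have "y \<noteq> v" using assms(4) by blast
  ultimately show ?thesis using y by blast
qed

lemma linkingD:
  assumes "linking X C C' s" "B \<in> C" "x \<in> X" "y \<in> X" "x \<noteq> y"
  shows "transpose x y ` B \<in> C \<Longrightarrow> transpose x y ` s B \<in> C'"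
    and "transpose x y ` s B \<in> C' \<Longrightarrow> transpose x y ` B \<in> C"
    and "transpose x y ` B \<in> C \<Longrightarrow> s (transpose x y ` B) = transpose x y ` s B"
  using assms unfolding linking_def by metis+

lemma transpose_image_swap:
  assumes "x \<in> S" "y \<notin> S"
  shows "transpose x y ` S = insert y (S - {x})"
  using assms by (auto simp: transpose_def image_iff)

lemma transpose_image_fixed:
  assumes "x \<in> S \<longleftrightarrow> y \<in> S"
  shows "transpose x y ` S = S"
  using assms by (simp add: transpose_image_eq)

theorem theorem9p1:
  fixes X :: "'a set" and \<B> \<B>' :: "'a set set" and star :: "'a set \<Rightarrow> 'a set"
    and \<omega> \<pi> :: "'a rel" and a z :: 'a and \<epsilon> :: "'a \<Rightarrow> 'a" and Q :: "'a set"
  assumes "finite X"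
    and "matroid X \<B>" and "matroid X \<B>'"
    and "linking X \<B> \<B>' star"
    and "linear_order_on X \<omega>" and "consecutive X \<omega> a z"
    and "linear_order_on X \<pi>" and "agree_except_swap \<omega> \<pi> a z"
    and "\<epsilon> = transpose a z"
    and "nonbranching \<B> \<omega> \<pi> Q"
    and "\<exists>A. branching \<B>' \<omega> \<pi> A \<and>
           (star (min_completion \<B> \<omega> Q) = insert a A \<or> star (min_completion \<B> \<omega> Q) = insert z A)"
  shows "nonbranching \<B> \<omega> \<pi> (\<epsilon> ` Q) \<and>
         balanced \<B> \<epsilon> \<omega> \<pi> Q \<and> balanced \<B> \<epsilon> \<omega> \<pi> (\<epsilon> ` Q)"
proof -
  let ?U = "completions \<B>" and ?p = "wo_rel.minim \<omega> (completions \<B> Q)"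
  let ?P = "min_completion \<B> \<omega> Q"
  note mat = assms(2,3) and lw = assms(5) and lp = assms(7) and sw = assms(8) and \<epsilon> = assms(9)
  have az: "a \<in> X" "z \<in> X" "a \<noteq> z" "(a, z) \<in> \<omega>"
    and cons: "\<And>x. x \<in> X \<Longrightarrow> x \<noteq> a \<Longrightarrow> x \<noteq> z \<Longrightarrow> (a, x) \<in> \<omega> \<Longrightarrow> (x, z) \<notin> \<omega>"
    using assms(6) unfolding consecutive_def by auto
  have agree: "(x, y) \<in> \<pi> \<longleftrightarrow> (x, y) \<in> \<omega>" if "{x, y} \<noteq> {a, z}" for x y
    using sw that unfolding agree_except_swap_def by blast
  have za: "(z, a) \<in> \<pi>" using sw unfolding agree_except_swap_def by blast
  have Q: "almost_basis \<B> Q" and nb: "?P = min_completion \<B> \<pi> Q"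
    using assms(10) unfolding nonbranching_def by auto
  obtain A where A: "branching \<B>' \<omega> \<pi> A" and PA: "star ?P = insert a A \<or> star ?P = insert z A"
    using assms(11) by blast
  note br = branchingD[OF mat(2) lw lp sw az(4) A]
  have aA: "a \<notin> A" "insert a A \<in> \<B>'" and zA: "z \<notin> A" "insert z A \<in> \<B>'"
    using br(1,2) unfolding completions_def by auto
  have pU: "?p \<in> ?U Q" and pmin: "\<And>x. x \<in> ?U Q \<Longrightarrow> (?p, x) \<in> \<omega>"
    using minim_completions[OF mat(1) lw Q] by blast+
  have P: "?P = insert ?p Q" by (simp add: min_completion_def)
  have pQ: "?p \<notin> Q" and PB: "?P \<in> \<B>" using pU P unfolding completions_def by auto
  have UX: "\<And>D. ?U D \<subseteq> X" using completions_in_ground[OF mat(1)] .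
  have pX: "?p \<in> X" using UX pU by blast

  have p\<pi>: "?p = wo_rel.minim \<pi> (?U Q)"
  proof -
    have "insert ?p Q = insert (wo_rel.minim \<pi> (?U Q)) Q"
      using nb by (simp add: min_completion_def)
    then show ?thesis using pQ by blast
  qed
  have pmin\<pi>: "\<And>x. x \<in> ?U Q \<Longrightarrow> (?p, x) \<in> \<pi>"
    unfolding p\<pi> using minim_completions(2)[OF mat(1) lp Q] .

  \<comment> \<open>Naming by \<open>v\<close> the element added to \<open>A\<close> treats the
    cases \<open>A + a\<close> and \<open>A + z\<close> at once.\<close>
  obtain u v where uv: "{u, v} = {a, z}" and Pv: "star ?P = insert v A"
    using PA that[of z a] that[of a z] insert_commute[of z a] by blast
  have uvA: "u \<noteq> v" "u \<notin> A" "v \<notin> A" "insert u A \<in> \<B>'" "insert v A \<in> \<B>'"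
    using uv aA zA az(3) by (auto simp: doubleton_eq_iff)
  have \<epsilon>v: "\<epsilon> ` insert v A = insert u A"
    using uv aA(1) zA(1) az(3) unfolding \<epsilon> doubleton_eq_iff
    by (auto simp: transpose_image_swap transpose_commute[of a z])
  \<comment> \<open>Both \<open>a\<close> and \<open>z\<close> complete \<open>A\<close>, so
    \<open>\<epsilon>\<close> sends \<open>star ?P\<close> to a basis; (L2) carries this back to
    \<open>?P\<close>.\<close>
  have \<epsilon>P: "\<epsilon> ` ?P \<in> \<B>" "star (\<epsilon> ` ?P) = insert u A"
    using linkingD(2,3)[OF assms(4) PB az(1-3)] \<epsilon>v uvA(4) Pv \<epsilon> by auto
  have "\<epsilon> ` ?P \<noteq> ?P" using \<epsilon>P(2) Pv uvA by force
  then have one: "a \<in> ?P \<longleftrightarrow> z \<notin> ?P"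
    using transpose_image_fixed[of a ?P z] \<epsilon> by blast

  \<comment> \<open>Otherwise \<open>?P\<close> and its image are \<open>Q + a\<close> and
    \<open>Q + z\<close>, so both elements complete \<open>Q\<close>. Then \<open>?p\<close> would
    lie weakly below \<open>a\<close> for \<open>\<omega>\<close> and weakly below \<open>z\<close>
    for \<open>\<pi>\<close>, which neither \<open>a\<close> nor \<open>z\<close> does.\<close>
  have paz: "?p \<noteq> a \<and> ?p \<noteq> z"
  proof (rule ccontr)
    assume p: "\<not> ?thesis"
    then have "a \<in> ?U Q \<and> z \<in> ?U Q"
      using one pQ PB \<epsilon>P(1) unfolding P \<epsilon> completions_def
      by (auto simp: transpose_image_eq insert_Diff_if)
    then have "(?p, a) \<in> \<omega>" "(?p, z) \<in> \<pi>" using pmin pmin\<pi> by auto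
    then show False
      using p az za linear_orderD(3)[OF lw] linear_orderD(3)[OF lp] by metis
  qed

  \<comment> \<open>How \<open>c\<close>, \<open>d\<close> match \<open>u\<close>, \<open>v\<close>
    is left open; the argument below does not depend on it.\<close>
  obtain c d where cd: "{c, d} = {a, z}" and cQ: "c \<in> Q" and dQ: "d \<notin> Q"
    using one paz that[of z a] that[of a z] insert_commute[of z a] unfolding P by blast
  define R where "R = Q - {c}"
  have QR: "Q = insert c R" "c \<notin> R" "d \<notin> R" "c \<noteq> d" "?p \<notin> R" "?p \<noteq> c" "?p \<noteq> d" "d \<in> X"
    using cQ dQ cd az pQ paz unfolding R_def by (auto simp: doubleton_eq_iff)
  have \<epsilon>cd: "\<epsilon> = transpose c d"
    using cd \<epsilon> by (auto simp: doubleton_eq_iff transpose_commute)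
  have \<epsilon>Q: "\<epsilon> ` Q = insert d R"
    using QR unfolding \<epsilon>cd by (simp add: transpose_image_swap)
  have \<epsilon>PR: "\<epsilon> ` ?P = insert ?p (insert d R)"
    unfolding P image_insert \<epsilon>Q using QR by (simp add: \<epsilon>cd)
  have \<epsilon>\<epsilon>: "\<epsilon> ` \<epsilon> ` S = S" for S by (simp add: \<epsilon> image_image)

  have not_between: False if "(a, ?p) \<in> \<omega>" "(?p, y) \<in> \<omega>" "y = a \<or> y = z" for y
    using that cons[of ?p] pX paz linear_orderD(3)[OF lw] by blast

  have least: "(?p, x) \<in> \<omega>" if x: "x \<in> ?U (\<epsilon> ` Q)" for x
  proof (rule ccontr)
    assume "(?p, x) \<notin> \<omega>"
    then have xp: "(x, ?p) \<in> \<omega>" "x \<noteq> ?p" and xX: "x \<in> X"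
      using linear_orderD(1,4)[OF lw] pX UX x by (metis subsetD)+
    have xd: "x \<notin> R" "x \<noteq> d" and N: "insert x (insert d R) \<in> \<B>"
      using x unfolding \<epsilon>Q completions_def by auto
    have dU: "(?p, d) \<in> \<omega>" if "insert d Q \<in> \<B>"
      using that pmin dQ unfolding completions_def by blast
    \<comment> \<open>The chain \<open>a \<le> x < ?p \<le> d\<close> with \<open>d\<close> in
      \<open>{a, z}\<close> would put \<open>?p\<close> strictly between \<open>a\<close> and
      \<open>z\<close>, or force \<open>?p = a\<close>.\<close>
    have ax: False if "(a, x) \<in> \<omega>" "(?p, d) \<in> \<omega>"
      using linear_orderD(2)[OF lw that(1) xp(1)] that(2) not_between[of d] cd by blast
    have xc: "x \<noteq> c"
    proof
      assume "x = c"
      then have pd: "(?p, d) \<in> \<omega>" using N dU QR(1) by (simp add: insert_commute)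
      have "(a, x) \<in> \<omega>"
        using cd \<open>x = c\<close> az(4) linear_orderD(1)[OF lw az(1)]
        by (auto simp: doubleton_eq_iff)
      then show False using ax pd by blast
    qed
    have Qx: "insert x Q \<notin> \<B>"
      using pmin[of x] xp xc xd QR(1) \<open>(?p, x) \<notin> \<omega>\<close> unfolding completions_def by auto
    \<comment> \<open>The bases are \<open>R + d + x\<close> and \<open>R + c + ?p\<close>, and
      \<open>R + c + x\<close> is no basis. Hence \<open>Q + d\<close> is one, and minimality of
      \<open>?p\<close> gives \<open>?p \<le> d\<close>.\<close>
    have "insert c (insert d R) \<in> \<B>"
      using matroid_pair_exchange[OF mat(1), of d x R c ?p] N PB Qx QR xp xc xd
      unfolding P by (simp add: insert_commute)
    then have pd: "(?p, d) \<in> \<omega>" using dU QR(1) by (simp add: insert_commute)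
    let ?\<tau> = "transpose ?p x"
    have "?\<tau> ` ?P = insert x Q"
      using xp xc xd QR pQ unfolding P by (subst transpose_image_swap) auto
    \<comment> \<open>Contrapositive of (L2) at \<open>?P\<close>; below, (L1) at the image of
      \<open>?P\<close> gives the opposite answer for \<open>A + u\<close>.\<close>
    then have \<tau>v: "?\<tau> ` insert v A \<notin> \<B>'"
      using linkingD(2)[OF assms(4) PB pX xX] xp(2) Qx Pv by auto
    have "?\<tau> ` \<epsilon> ` ?P = insert x (insert d R)"
      using xp xc xd QR unfolding \<epsilon>PR by (subst transpose_image_swap) auto
    then have \<tau>u: "?\<tau> ` insert u A \<in> \<B>'"
      using linkingD(1)[OF assms(4) \<epsilon>P(1) pX xX] xp(2) N \<epsilon>P(2) by auto
    have xaz: "x \<noteq> u" "x \<noteq> v" "?p \<noteq> u" "?p \<noteq> v"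
      using xc xd(2) paz uv cd by blast+
    \<comment> \<open>If \<open>A\<close> contained both or neither of \<open>?p\<close> and
      \<open>x\<close>, the transposition would fix the basis \<open>A + v\<close>.\<close>
    have "\<not> (?p \<in> A \<longleftrightarrow> x \<in> A)"
      using \<tau>v uvA(5) xaz transpose_image_fixed[of ?p "insert v A" x] by (metis insert_iff)
    then obtain s t where st: "{s, t} = {?p, x}" "s \<in> A" "t \<notin> A" by blast
    define A' where "A' = A - {s}"
    have A': "A = insert s A'" "s \<notin> A'" "t \<notin> A'" "u \<notin> A'" "v \<notin> A'"
      "s \<noteq> t" "u \<noteq> t" "u \<noteq> s" "v \<noteq> t" "v \<noteq> s"
      using st uvA xaz unfolding A'_def by (auto simp: doubleton_eq_iff)
    have \<tau>: "?\<tau> = transpose s t"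
      using st(1) by (auto simp: doubleton_eq_iff transpose_commute)
    have "?\<tau> ` insert y A = insert t (insert y A')" if "y \<in> {u, v}" for y
      using A' that unfolding \<tau> by (subst transpose_image_swap) auto
    then have "insert t (insert u A') \<in> \<B>'" "insert t (insert v A') \<notin> \<B>'"
      using \<tau>u \<tau>v by auto
    moreover have "insert s (insert v A') \<in> \<B>'"
      using uvA(5) A'(1) by (simp add: insert_commute)
    \<comment> \<open>The set obtained is \<open>A + t\<close>, so \<open>t\<close> completes
      \<open>A\<close> and cannot lie below \<open>a\<close>. As \<open>t\<close> is
      \<open>?p\<close> or \<open>x\<close>, this contradicts \<open>?p \<le> d\<close> in either
      case.\<close>
    ultimately have "insert t (insert s A') \<in> \<B>'"
      using matroid_pair_exchange[OF mat(2), of s v A' t u] uvA(1) A' by blast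
    then have "(a, t) \<in> \<omega>"
      using br(3) st(3) A'(1) unfolding completions_def by auto
    then have "(a, x) \<in> \<omega> \<or> (a, ?p) \<in> \<omega>" using st(1) by (auto simp: doubleton_eq_iff)
    then show False using ax pd not_between cd by blast
  qed
  have pU': "?p \<in> ?U (\<epsilon> ` Q)"
    using \<epsilon>P(1) QR unfolding \<epsilon>PR \<epsilon>Q completions_def by auto
  \<comment> \<open>Since \<open>?p\<close> is neither \<open>a\<close> nor \<open>z\<close>, both
    orders compare it with \<open>x\<close> in the same way.\<close>
  have least\<pi>: "(?p, x) \<in> \<pi>" if "x \<in> ?U (\<epsilon> ` Q)" for x
    using least[OF that] agree[of ?p x] paz by (auto simp: doubleton_eq_iff)
  \<comment> \<open>Both orders complete \<open>Q\<close> to \<open>?P\<close> and its image to the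
    image of \<open>?P\<close>; as \<open>\<epsilon>\<close> is an involution, all four balance
    conditions follow.\<close>
  have "min_completion \<B> \<omega> (\<epsilon> ` Q) = \<epsilon> ` ?P" "min_completion \<B> \<pi> (\<epsilon> ` Q) = \<epsilon> ` ?P"
    using min_completion_eq[OF mat(1) lw pU' least] min_completion_eq[OF mat(1) lp pU' least\<pi>]
    unfolding \<epsilon>PR \<epsilon>Q by auto
  then show ?thesis
    using almost_basis_completion[OF pU'] Q nb \<epsilon>\<epsilon>
    unfolding nonbranching_def balanced_def balanced_from_def by auto
qed

end
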